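(* Let $s \geq 1$ and $N \geq 1$ be integers and let $q \in (0,1)$. Let $z_1, \ldots, z_N$ be independent random variables, each uniformly distributed on $[0,1]^s$. Then, with probability at least $q$, $$D^*_N(z_1, \ldots, z_N) \leq 5.7 \sqrt{4.9 + \frac{\log \left((1-q)^{-1}\right)}{s}} \, \frac{\sqrt{s}}{\sqrt{N}}.$$
   Context: For $x = (x_1,\ldots,x_s)$ and $y = (y_1,\ldots,y_s)$ in $[0,1]^s$, write $y \leq x$ if $y_i \leq x_i$ for all $1 \leq i \leq s$, and let $[0,x] = \{y \in [0,1]^s : 0 \leq y \leq x\}$. Let $\lambda$ denote the $s$-dimensional Lebesgue measure. The star-discrepancy of points $z_1, \ldots, z_N \in [0,1]^s$ is $$D_N^*(z_1,\ldots,z_N) = \sup_{x \in [0,1]^s} \left| \frac{1}{N} \sum_{n=1}^N \mathbf{1}_{[0,x]}(z_n) - \lambda([0,x]) \right|.$$ Here $\log$ denotes the natural logarithm. *)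

theory Defs
  imports "HOL-Probability.Probability"
begin

text \<open>The dimension \<open>s\<close> is \<open>CARD('s)\<close>; the order on \<^typ>\<open>real ^ 's\<close> is the componentwise one,
  so \<open>{0..1}\<close> is the cube $[0,1]^s$.\<close>

definition unit_box :: "(real ^ 's) set" where
  "unit_box = {0..1}"

definition anchored_box :: "real ^ 's \<Rightarrow> (real ^ 's) set" where
  "anchored_box x = {y \<in> unit_box. 0 \<le> y \<and> y \<le> x}"

text \<open>The points are $z_1, \ldots, z_N$. For \<open>N \<ge> 1\<close> the family below is bounded by 1,
  so the supremum in the reals is the intended one.\<close>

definition star_discrepancy :: "nat \<Rightarrow> (nat \<Rightarrow> real ^ 's) \<Rightarrow> real" where
  "star_discrepancy N z =
     (SUP x \<in> unit_box. \<bar>(1 / real N) * (\<Sum>n = 1..N. indicator (anchored_box x) (z n))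
                          - measure lborel (anchored_box x)\<bar>)"

end

theory Submission
  imports Defs
begin

text \<open>
  Write \<open>\<nu>(A)\<close> for the local discrepancy of a set \<open>A\<close>, the fraction of sample points in \<open>A\<close> minus the
  Lebesgue measure of \<open>A\<close>, write \<open>s\<close> for the dimension and \<open>L = - log (1 - q)\<close>, and let \<open>\<epsilon>\<close> be the
  asserted bound, so that \<open>N \<epsilon>\<^sup>2 = 32.49 (4.9 s + L)\<close>. The proof is a chaining argument over
  anchored boxes.

  For each \<open>k \<ge> 1\<close> there is a family of at most \<open>(e 8^k)^s\<close> anchored boxes such that every anchored
  box lies between a member (or the empty set) and a member, the two differing in measure by at
  most \<open>4^(-k)\<close> (\<open>card_level_family_le\<close>, \<open>level_bracket\<close>). The corners of its boxes
  have coordinates \<open>r ^ n\<close> with natural numbers \<open>n\<close>, where \<open>r ^ s = exp (- 4^(-k))\<close>. On this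
  geometric grid the volume of a box depends only on the sum of the exponents, so only the exponent
  vectors of bounded sum matter, and there are few of them. A grid of equally spaced points
  would instead cost a factor \<open>s ^ s\<close>.

  Each member \<open>B\<close> of level \<open>k + 1\<close> has a parent \<open>A \<subseteq> B\<close>, which is a member of level \<open>k\<close> or empty,
  with \<open>\<lambda>(B - A) \<le> 4^(-k)\<close>. If \<open>\<bar>\<nu>(B - A)\<bar> \<le> t k\<close> for all such increments with \<open>k < K\<close>, then
  telescoping and one bracket at level \<open>K\<close> bound the star discrepancy by
  \<open>(\<Sum>k<K. t k) + 4^(-K)\<close> (\<open>local_disc_box_le\<close>). A Bernstein bound (\<open>bernstein_sum_indicator\<close>) makes a
  large \<open>\<nu>(B - A)\<close> improbable because \<open>B - A\<close> has measure at most \<open>4^(-k)\<close>. If \<open>\<epsilon> \<ge> 1\<close> there is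
  nothing to prove. Otherwise choose \<open>t k = 0.3 * 0.6^k * \<epsilon>\<close> and the least \<open>K\<close> with
  \<open>4^(-K) \<le> \<epsilon> / 4\<close>: the \<open>t k\<close> sum to at most \<open>0.75 * \<epsilon>\<close>, the thresholds stay in the range where the
  Gaussian part of the Bernstein bound dominates, and the union bound over the increments from
  level \<open>k + 1\<close> to level \<open>k\<close> is at most \<open>2^(-k-1) * (1 - q)\<close> (\<open>level_failure_le\<close>). Summing over \<open>k\<close>
  leaves a failure probability of at most
  \<open>1 - q\<close>.
\<close>

section \<open>A Bernstein bound for empirical frequencies\<close>

text \<open>Bernstein's choice of parameter below is at most \<open>6 / 7\<close>, and up to that point \<open>0.7\<close> can serve as
  the coefficient of the quadratic remainder of the exponential, instead of its limit \<open>1 / 2\<close>.\<close>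

lemma exp_second_order_bound:
  fixes u :: real
  assumes "\<bar>u\<bar> \<le> 6 / 7"
  shows "exp u \<le> 1 + u + 0.7 * u\<^sup>2"
proof -
  obtain v where v: "\<bar>v\<bar> \<le> \<bar>u\<bar>" and e: "exp u = (\<Sum>m<5. u ^ m / fact m) + exp v / fact 5 * u ^ 5"
    using Maclaurin_exp_le by blast
  have "exp v \<le> exp 1" using v assms by simp
  also have "\<dots> \<le> 3" using exp_le by simp
  finally have v3: "exp v \<le> 3" .
  have eq: "exp u = 1 + u + u\<^sup>2 * (1/2 + u/6 + u\<^sup>2/24 + exp v / 120 * u^3)"
    unfolding e by (simp add: lessThan_nat_numeral lessThan_Suc fact_numeral eval_nat_numeral algebra_simps)
  have "u \<le> 6/7" using assms by simp
  have "u\<^sup>2 \<le> (6/7)\<^sup>2" using power_mono[OF assms, of 2] by simp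
  then have sq: "u\<^sup>2 \<le> 36/49" by (simp add: power2_eq_square)
  have "u^3 \<le> \<bar>u\<bar>^3" by (metis abs_ge_self power_abs)
  also have "\<dots> \<le> (6/7)^3" using assms by (rule power_mono) simp
  finally have cu: "u^3 \<le> (6/7)^3" .
  have "exp v / 120 * u^3 \<le> 3/120 * (6/7)^3"
  proof (cases "u \<ge> 0")
    case True then show ?thesis using cu v3 by (intro mult_mono) auto
  next
    case False
    then have "exp v / 120 * u^3 \<le> 0" by (intro mult_nonneg_nonpos) (auto simp: power_le_zero_eq)
    then show ?thesis by (rule order_trans) simp
  qed
  then have "1/2 + u/6 + u\<^sup>2/24 + exp v / 120 * u^3 \<le> 0.7"
    using sq \<open>u \<le> 6/7\<close> by (simp add: power3_eq_cube)
  then have "u\<^sup>2 * (1/2 + u/6 + u\<^sup>2/24 + exp v / 120 * u^3) \<le> u\<^sup>2 * 0.7"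
    by (intro mult_left_mono) auto
  then show ?thesis unfolding eq by simp
qed

context prob_space
begin

text \<open>The moment generating function of a centred Bernoulli sum is at most that of the centred Poisson
  variable of the same mean.\<close>

lemma expectation_exp_sum_indicator_le:
  assumes indep: "indep_vars (\<lambda>_. borel) z I" and I: "finite I" "I \<noteq> {}"
    and S[measurable]: "S \<in> sets borel"
    and pS: "\<And>n. n \<in> I \<Longrightarrow> prob (z n -` S \<inter> space M) = p"
  shows "integrable M (\<lambda>\<omega>. exp (\<theta> * (\<Sum>n\<in>I. indicator S (z n \<omega>) - p)))" (is ?int)
    and "expectation (\<lambda>\<omega>. exp (\<theta> * (\<Sum>n\<in>I. indicator S (z n \<omega>) - p)))
           \<le> exp (real (card I) * (p * (exp \<theta> - 1 - \<theta>)))" (is ?le)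
proof -
  let ?f = "\<lambda>x. exp (\<theta> * (indicator S x - p)) :: real"
  have rv[measurable]: "z n \<in> borel_measurable M" if "n \<in> I" for n
    using indep that unfolding indep_vars_def by auto
  have ind: "indep_vars (\<lambda>_. borel) (\<lambda>n \<omega>. ?f (z n \<omega>)) I"
    by (rule indep_vars_compose2[OF indep]) measurable
  have prod: "exp (\<theta> * (\<Sum>n\<in>I. indicator S (z n \<omega>) - p)) = (\<Prod>n\<in>I. ?f (z n \<omega>))" for \<omega>
    by (simp add: sum_distrib_left exp_sum I)
  have intg: "integrable M (\<lambda>\<omega>. indicator S (z n \<omega>) :: real)" if "n \<in> I" for n
    using that by (intro integrable_const_bound[where B=1]) auto
  have form: "?f x = exp (- \<theta> * p) * (1 + (exp \<theta> - 1) * indicator S x)" for x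
    by (auto simp: indicator_def exp_add[symmetric] algebra_simps)
  have i1: "integrable M (\<lambda>\<omega>. ?f (z n \<omega>))" if "n \<in> I" for n
    unfolding form using intg[OF that] by simp
  have eS: "expectation (\<lambda>\<omega>. indicator S (z n \<omega>) :: real) = p" if "n \<in> I" for n
  proof -
    have "expectation (\<lambda>\<omega>. indicator S (z n \<omega>) :: real)
        = expectation (indicator (z n -` S \<inter> space M))"
      by (intro Bochner_Integration.integral_cong) (auto simp: indicator_def)
    also have "\<dots> = prob (z n -` S \<inter> space M)"
      by (simp add: Int_assoc)
    finally show ?thesis using pS[OF that] by simp
  qed
  have e1: "expectation (\<lambda>\<omega>. ?f (z n \<omega>)) = exp (- \<theta> * p) * (1 + (exp \<theta> - 1) * p)"
    if "n \<in> I" for n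
    unfolding form using intg[OF that] eS[OF that] by (simp add: prob_space)
  show ?int unfolding prod using ind i1 I by (intro indep_vars_integrable) auto
  have "expectation (\<lambda>\<omega>. exp (\<theta> * (\<Sum>n\<in>I. indicator S (z n \<omega>) - p)))
      = (\<Prod>n\<in>I. expectation (\<lambda>\<omega>. ?f (z n \<omega>)))"
    unfolding prod using ind i1 I by (intro indep_vars_lebesgue_integral) auto
  also have "\<dots> = (exp (- \<theta> * p) * (1 + (exp \<theta> - 1) * p)) ^ card I"
    by (simp add: e1)
  also have "\<dots> \<le> (exp (- \<theta> * p) * exp ((exp \<theta> - 1) * p)) ^ card I"
  proof (intro power_mono mult_left_mono)
    obtain n where "n \<in> I" using I by auto
    then have "expectation (\<lambda>\<omega>. ?f (z n \<omega>)) \<ge> 0" by (intro integral_nonneg_AE) auto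
    then show "0 \<le> exp (- \<theta> * p) * (1 + (exp \<theta> - 1) * p)" using e1[OF \<open>n \<in> I\<close>] by simp
  qed auto
  also have "\<dots> = exp (real (card I) * (p * (exp \<theta> - 1 - \<theta>)))"
    by (simp add: exp_of_nat_mult[symmetric] exp_add[symmetric] algebra_simps)
  finally show ?le .
qed

text \<open>The sign \<open>\<sigma>\<close> selects the upper or the lower tail.\<close>

lemma chernoff_sum_indicator:
  assumes indep: "indep_vars (\<lambda>_. borel) z I" and I: "finite I" "I \<noteq> {}"
    and S[measurable]: "S \<in> sets borel"
    and pS: "\<And>n. n \<in> I \<Longrightarrow> prob (z n -` S \<inter> space M) = p"
    and p: "p \<le> v" and v: "v > 0" and t: "0 \<le> t" "t \<le> 1.2 * v"
    and sg: "\<bar>\<sigma>\<bar> = 1"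
  shows "prob {\<omega> \<in> space M. \<sigma> * (\<Sum>n\<in>I. indicator S (z n \<omega>) - p) \<ge> real (card I) * t}
           \<le> exp (- real (card I) * t\<^sup>2 / (2.8 * v))"
proof -
  \<comment> \<open>This choice minimises \<open>0.7 * v * \<theta>\<^sup>2 - \<theta> * t\<close>, and \<open>t \<le> 1.2 * v\<close> gives \<open>\<theta> \<le> 6 / 7\<close>.\<close>
  define \<theta> where "\<theta> = t / (1.4 * v)"
  have \<theta>0: "\<theta> \<ge> 0" using t v by (simp add: \<theta>_def)
  have "\<theta> \<le> (1.2 * v) / (1.4 * v)" unfolding \<theta>_def using t v by (intro divide_right_mono) auto
  then have \<theta>1: "\<theta> \<le> 6/7" using v by simp
  have [measurable]: "z n \<in> borel_measurable M" if "n \<in> I" for n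
    using indep that unfolding indep_vars_def by auto
  let ?X = "\<lambda>\<omega>. (\<Sum>n\<in>I. indicator S (z n \<omega>) - p)"
  let ?u = "\<lambda>\<omega>. exp (\<sigma> * \<theta> * ?X \<omega>)"
  note mgf = expectation_exp_sum_indicator_le[OF indep I S pS, where \<theta> = "\<sigma> * \<theta>"]
  obtain n where n: "n \<in> I" using I by auto
  have p0: "p \<ge> 0" using pS[OF n] by (metis measure_nonneg)
  have "prob {\<omega> \<in> space M. \<sigma> * ?X \<omega> \<ge> real (card I) * t}
      \<le> prob {\<omega> \<in> space M. ?u \<omega> \<ge> exp (\<theta> * (real (card I) * t))}"
  proof (intro finite_measure_mono subsetI)
    fix \<omega> assume "\<omega> \<in> {\<omega> \<in> space M. \<sigma> * ?X \<omega> \<ge> real (card I) * t}"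
    then show "\<omega> \<in> {\<omega> \<in> space M. ?u \<omega> \<ge> exp (\<theta> * (real (card I) * t))}"
      using mult_left_mono[of "real (card I) * t" "\<sigma> * ?X \<omega>" \<theta>] \<theta>0
      by (simp add: mult_ac)
  qed measurable
  also have "\<dots> \<le> expectation ?u / exp (\<theta> * (real (card I) * t))"
    by (rule integral_Markov_inequality_measure[where A="{}"]) (use mgf in auto)
  also have "\<dots> \<le> exp (real (card I) * (p * (exp (\<sigma> * \<theta>) - 1 - \<sigma> * \<theta>))) / exp (\<theta> * (real (card I) * t))"
    by (intro divide_right_mono) (use mgf in auto)
  also have "\<dots> = exp (real (card I) * (p * (exp (\<sigma> * \<theta>) - 1 - \<sigma> * \<theta>)) - \<theta> * (real (card I) * t))"
    by (simp add: exp_diff)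
  also have "\<dots> \<le> exp (- real (card I) * t\<^sup>2 / (2.8 * v))"
  proof -
    have "p * (exp (\<sigma> * \<theta>) - 1 - \<sigma> * \<theta>) \<le> v * (0.7 * \<theta>\<^sup>2)"
    proof (intro mult_mono)
      have "\<bar>\<sigma> * \<theta>\<bar> \<le> 6/7" using \<theta>0 \<theta>1 sg by (simp add: abs_mult)
      moreover have "\<sigma>\<^sup>2 = 1" using sg by (metis abs_1 power2_abs power_one)
      ultimately show "exp (\<sigma> * \<theta>) - 1 - \<sigma> * \<theta> \<le> 0.7 * \<theta>\<^sup>2"
        using exp_second_order_bound[of "\<sigma> * \<theta>"] by (simp add: power_mult_distrib)
      show "0 \<le> exp (\<sigma> * \<theta>) - 1 - \<sigma> * \<theta>" using exp_ge_add_one_self[of "\<sigma> * \<theta>"] by linarith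
    qed (use p v in auto)
    then have "p * (exp (\<sigma> * \<theta>) - 1 - \<sigma> * \<theta>) - \<theta> * t \<le> v * (0.7 * \<theta>\<^sup>2) - \<theta> * t" by simp
    also have "\<dots> = - (t\<^sup>2 / (2.8 * v))"
      using v by (simp add: \<theta>_def field_simps power2_eq_square)
    finally have "real (card I) * (p * (exp (\<sigma> * \<theta>) - 1 - \<sigma> * \<theta>) - \<theta> * t)
        \<le> real (card I) * - (t\<^sup>2 / (2.8 * v))"
      by (rule mult_left_mono) simp
    then show ?thesis by (simp add: algebra_simps)
  qed
  finally show ?thesis .
qed

lemma bernstein_sum_indicator:
  assumes indep: "indep_vars (\<lambda>_. borel) z I" and I: "finite I" "I \<noteq> {}"
    and S[measurable]: "S \<in> sets borel"
    and pS: "\<And>n. n \<in> I \<Longrightarrow> prob (z n -` S \<inter> space M) = p"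
    and p: "p \<le> v" and v: "v > 0" and t: "0 \<le> t" "t \<le> 1.2 * v"
  shows "prob {\<omega> \<in> space M. \<bar>(1 / real (card I)) * (\<Sum>n\<in>I. indicator S (z n \<omega>)) - p\<bar> > t}
           \<le> 2 * exp (- real (card I) * t\<^sup>2 / (2.8 * v))"
proof -
  let ?E = "\<lambda>\<sigma>. {\<omega> \<in> space M. \<sigma> * (\<Sum>n\<in>I. indicator S (z n \<omega>) - p) \<ge> real (card I) * t}"
  have c: "real (card I) > 0" using I by (simp add: card_gt_0_iff)
  have [measurable]: "z n \<in> borel_measurable M" if "n \<in> I" for n
    using indep that unfolding indep_vars_def by auto
  have [measurable]: "?E \<sigma> \<in> events" for \<sigma> by measurable
  have "prob {\<omega> \<in> space M. \<bar>(1 / real (card I)) * (\<Sum>n\<in>I. indicator S (z n \<omega>)) - p\<bar> > t}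
      \<le> prob (?E 1 \<union> ?E (-1))"
  proof (intro finite_measure_mono subsetI)
    fix \<omega> assume *: "\<omega> \<in> {\<omega> \<in> space M. \<bar>(1 / real (card I)) * (\<Sum>n\<in>I. indicator S (z n \<omega>)) - p\<bar> > t}"
    have "(\<Sum>n\<in>I. indicator S (z n \<omega>) - p)
        = real (card I) * ((1 / real (card I)) * (\<Sum>n\<in>I. indicator S (z n \<omega>)) - p)" (is "_ = _ * ?d")
      using c by (simp add: sum_subtractf field_simps)
    moreover have "t \<le> ?d \<or> t \<le> - ?d" using * by auto
    ultimately show "\<omega> \<in> ?E 1 \<union> ?E (-1)"
      using * c by (auto simp flip: mult_minus_right)
  qed measurable
  also have "\<dots> \<le> prob (?E 1) + prob (?E (-1))" by (rule measure_Un_le) auto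
  also have "\<dots> \<le> 2 * exp (- real (card I) * t\<^sup>2 / (2.8 * v))"
    using chernoff_sum_indicator[OF indep I S pS p v t, of 1]
      chernoff_sum_indicator[OF indep I S pS p v t, of "-1"] by simp
  finally show ?thesis .
qed

end

section \<open>Exponent vectors of bounded sum\<close>
text \<open>The index functions with natural values whose sum is at most \<open>m\<close>.\<close>

definition exponents :: "nat \<Rightarrow> ('s::finite \<Rightarrow> nat) set" where
  "exponents m = {f. sum f UNIV \<le> m}"

lemma finite_exponents: "finite (exponents m :: ('s::finite \<Rightarrow> nat) set)"
proof (rule finite_subset)
  show "exponents m \<subseteq> PiE (UNIV :: 's set) (\<lambda>_. {..m})"
  proof
    fix f :: "'s \<Rightarrow> nat" assume f: "f \<in> exponents m"
    have "f i \<le> m" for i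
      using f member_le_sum[of i UNIV f] by (auto simp: exponents_def)
    then show "f \<in> PiE UNIV (\<lambda>_. {..m})" by auto
  qed
qed (auto intro: finite_PiE)

text \<open>A Rankin-type bound: for \<open>x \<in> (0,1)\<close>, each \<open>f\<close> counted has \<open>x ^ (s * M) \<le> x ^ sum f\<close>, and the sum of
  \<open>x ^ sum f\<close> over all \<open>f\<close> is a product of geometric series.\<close>

lemma card_exponents_le:
  assumes M: "M \<ge> 1"
  shows "real (card (exponents (CARD('s) * M) :: ('s::finite \<Rightarrow> nat) set))
           \<le> (exp 1 * (real M + 1)) ^ CARD('s)"
proof -
  let ?s = "CARD('s)"
  let ?G = "exponents (?s * M) :: ('s \<Rightarrow> nat) set"
  let ?P = "PiE (UNIV :: 's set) (\<lambda>_. {..?s * M})"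
  \<comment> \<open>The value minimising \<open>x ^ (- M) / (1 - x)\<close>.\<close>
  define x where "x = real M / (real M + 1)"
  have x: "0 < x" "x < 1" using M by (auto simp: x_def)
  have sub: "?G \<subseteq> ?P"
  proof
    fix f :: "'s \<Rightarrow> nat" assume f: "f \<in> ?G"
    have "f i \<le> ?s * M" for i
      using f member_le_sum[of i UNIV f] by (auto simp: exponents_def)
    then show "f \<in> ?P" by auto
  qed
  have "real (card ?G) * x ^ (?s * M) = (\<Sum>f\<in>?G. x ^ (?s * M))" by simp
  also have "\<dots> \<le> (\<Sum>f\<in>?G. x ^ sum f UNIV)"
    using x by (intro sum_mono power_decreasing) (auto simp: exponents_def)
  also have "\<dots> \<le> (\<Sum>f\<in>?P. x ^ sum f UNIV)"
    using x sub by (intro sum_mono2) (auto intro: finite_PiE)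
  also have "\<dots> = (\<Sum>f\<in>?P. \<Prod>i\<in>UNIV. x ^ f i)" by (simp add: power_sum)
  also have "\<dots> = (\<Prod>i\<in>(UNIV::'s set). \<Sum>j\<le>?s * M. x ^ j)"
    by (subst prod_sum_PiE) auto
  also have "\<dots> = (\<Sum>j\<le>?s * M. x ^ j) ^ ?s" by simp
  also have "\<dots> \<le> (1 / (1 - x)) ^ ?s"
  proof (intro power_mono)
    have "(\<Sum>j\<le>?s * M. x ^ j) \<le> (\<Sum>j. x ^ j)"
      using x by (intro sum_le_suminf summable_geometric) auto
    also have "\<dots> = 1 / (1 - x)" using x by (intro suminf_geometric) auto
    finally show "(\<Sum>j\<le>?s * M. x ^ j) \<le> 1 / (1 - x)" .
  qed (use x in \<open>auto intro: sum_nonneg\<close>)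
  also have "1 / (1 - x) = real M + 1" by (simp add: x_def field_simps)
  finally have "real (card ?G) * x ^ (?s * M) \<le> (real M + 1) ^ ?s" .
  then have "real (card ?G) \<le> (real M + 1) ^ ?s / x ^ (?s * M)"
    using x by (simp add: pos_le_divide_eq)
  also have "\<dots> = ((real M + 1) * (1 / x) ^ M) ^ ?s"
    by (simp add: power_mult_distrib power_divide power_mult[symmetric] mult.commute)
  also have "\<dots> \<le> ((real M + 1) * exp 1) ^ ?s"
  proof (intro power_mono mult_left_mono)
    have "1 / x = 1 + 1 / real M" using M by (simp add: x_def field_simps)
    also have "\<dots> ^ M \<le> exp 1"
      using exp_ge_one_plus_x_over_n_power_n[of M 1] M by simp
    finally show "(1 / x) ^ M \<le> exp 1" by (simp add: power_one_over)
  qed (use x in auto)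
  finally show ?thesis by (simp add: mult.commute)
qed

text \<open>A vector of exponents can be decreased, unit by unit, to any smaller sum.\<close>

lemma exists_smaller_exponents:
  fixes f :: "'s::finite \<Rightarrow> nat"
  assumes "m \<le> sum f UNIV"
  shows "\<exists>g. g \<le> f \<and> sum g UNIV = m"
  using assms
proof (induction "sum f UNIV - m" arbitrary: f)
  case 0
  then show ?case by (intro exI[of _ f]) auto
next
  case (Suc d)
  then have "sum f UNIV > 0" by linarith
  then obtain i where i: "f i > 0" by (metis bot_nat_0.not_eq_extremum sum.neutral)
  let ?f = "f(i := f i - 1)"
  have "sum f UNIV = f i + sum f (UNIV - {i})" by (simp add: sum.remove)
  moreover have "sum ?f UNIV = ?f i + sum ?f (UNIV - {i})" by (rule sum.remove) auto
  moreover have "sum ?f (UNIV - {i}) = sum f (UNIV - {i})" by (intro sum.cong) auto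
  ultimately have "sum ?f UNIV = sum f UNIV - 1" using i by simp
  then have "d = sum ?f UNIV - m" "m \<le> sum ?f UNIV" using Suc by auto
  then obtain g where "g \<le> ?f" "sum g UNIV = m" using Suc(1) by blast
  moreover have "?f \<le> f" by (auto simp: le_fun_def)
  ultimately have "g \<le> f \<and> sum g UNIV = m" by (blast intro: order_trans)
  then show ?case by (rule exI[of _ g])
qed

section \<open>Anchored boxes\<close>

lemma anchored_box_eq: "x \<in> unit_box \<Longrightarrow> anchored_box x = {0..x}"
  by (auto simp: anchored_box_def unit_box_def intro: order_trans)

lemma anchored_box_borel[measurable]: "anchored_box x \<in> sets borel"
proof -
  have "anchored_box x = {0..1} \<inter> {0..x}" by (auto simp: anchored_box_def unit_box_def)
  then show ?thesis by (simp add: interval_cbox_cart)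
qed

lemma in_unit_box_iff: "x \<in> unit_box \<longleftrightarrow> (\<forall>i. 0 \<le> x $ i \<and> x $ i \<le> 1)"
  by (auto simp: unit_box_def less_eq_vec_def)

lemma in_anchored_box_iff:
  "y \<in> anchored_box x \<longleftrightarrow> (\<forall>i. 0 \<le> y $ i \<and> y $ i \<le> 1 \<and> y $ i \<le> x $ i)"
  by (auto simp: anchored_box_def unit_box_def less_eq_vec_def)

lemma anchored_box_mono: "x \<le> y \<Longrightarrow> anchored_box x \<subseteq> anchored_box y"
  by (auto simp: anchored_box_def intro: order_trans)

lemma measure_anchored_box:
  assumes "x \<in> unit_box"
  shows "measure lborel (anchored_box x) = (\<Prod>i\<in>UNIV. x $ i)"
proof -
  have "0 \<le> x" using assms by (simp add: unit_box_def)
  then have "{0..x} \<noteq> {}" by simp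
  then show ?thesis
    using content_cbox_cart[of 0 x] assms by (simp add: anchored_box_eq interval_cbox_cart)
qed

lemma one_in_unit_box: "1 \<in> (unit_box :: (real ^ 's) set)" 
  by (simp add: in_unit_box_iff)

lemma unit_box_eq_anchored_box: "unit_box = anchored_box (1 :: real ^ 's)" 
  by (auto simp: in_unit_box_iff in_anchored_box_iff)

lemma measure_unit_box: "measure lborel (unit_box :: (real ^ 's) set) = 1"
  unfolding unit_box_eq_anchored_box by (simp add: measure_anchored_box one_in_unit_box)

lemma unit_box_borel[measurable]: "(unit_box :: (real ^ 's) set) \<in> sets borel"
  unfolding unit_box_eq_anchored_box by (rule anchored_box_borel)

lemma emeasure_unit_box: "emeasure lborel (unit_box :: (real ^ 's) set) = 1"
  using measure_unit_box[where 's='s]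
  by (metis emeasure_eq_ennreal_measure ennreal_1 infinity_ennreal_def measure_def one_neq_zero
      enn2real_top)

lemma anchored_box_fmeasurable: "anchored_box x \<in> fmeasurable lborel"
proof (rule fmeasurableI2)
  show "(unit_box :: (real ^ 's) set) \<in> fmeasurable lborel"
    by (intro fmeasurableI) (auto simp: emeasure_unit_box)
qed (auto simp: anchored_box_def)

section \<open>Brackets on a geometric grid\<close>

text \<open>The grid point with coordinates \<open>r ^ f i\<close>; the ratio \<open>r\<close> lies in \<open>(0,1)\<close>, so larger exponents
  give smaller boxes.\<close>

definition grid_point :: "real \<Rightarrow> ('s::finite \<Rightarrow> nat) \<Rightarrow> real ^ 's" where
  "grid_point r f = (\<chi> i. r ^ f i)"

text \<open>The boxes anchored at the grid points whose exponents sum to at most \<open>m\<close>, that is, the grid boxes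
  of volume at least \<open>r ^ m\<close>.\<close>

definition grid_boxes :: "real \<Rightarrow> nat \<Rightarrow> (real ^ 's::finite) set set" where
  "grid_boxes r m = (\<lambda>f. anchored_box (grid_point r f)) ` exponents m"

lemma grid_point_in_unit_box: "0 \<le> r \<Longrightarrow> r \<le> 1 \<Longrightarrow> grid_point r f \<in> unit_box"
  by (auto simp: in_unit_box_iff grid_point_def power_le_one)

lemma measure_grid_box:
  assumes "0 \<le> r" "r \<le> 1"
  shows "measure lborel (anchored_box (grid_point r f)) = r ^ sum f UNIV"
  by (subst measure_anchored_box[OF grid_point_in_unit_box[OF assms]])
    (simp add: grid_point_def power_sum)

text \<open>Round each coordinate of \<open>x\<close> up to a power of \<open>r\<close>. If the resulting box is not too small, raising
  all exponents by one gives the lower box, whose volume is smaller by the factor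
  \<open>r ^ CARD('s)\<close>. Otherwise the lower set is empty, and the exponents of the upper box
  are decreased to sum exactly to \<open>m - CARD('s)\<close>, which keeps it in the family and makes it small.\<close>

lemma grid_bracket:
  fixes x :: "real ^ 's::finite"
  assumes x: "x \<in> unit_box" and r: "0 < r" "r < 1" and m: "m \<ge> CARD('s)"
  shows "\<exists>A \<in> insert {} (grid_boxes r m). \<exists>B \<in> grid_boxes r m. A \<subseteq> anchored_box x \<and>
           anchored_box x \<subseteq> B \<and>
           measure lborel B - measure lborel A \<le> max (1 - r ^ CARD('s)) (r ^ (m - CARD('s)))"
proof -
  \<comment> \<open>The cap \<open>m\<close> on the exponents is needed for coordinates that vanish or are tiny.\<close>
  have "\<exists>n\<le>m. x $ i \<le> r ^ n \<and> (n = m \<or> r ^ Suc n < x $ i)" for i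
  proof -
    let ?Q = "\<lambda>n. n \<le> m \<and> x $ i \<le> r ^ n"
    define n where "n = (GREATEST n. ?Q n)"
    have "?Q 0" using x by (simp add: in_unit_box_iff)
    then have n: "?Q n" unfolding n_def by (rule GreatestI_nat[where b=m]) auto
    have "n = m \<or> r ^ Suc n < x $ i"
    proof (rule ccontr)
      assume c: "\<not> ?thesis"
      then have "?Q (Suc n)" using n by auto
      then have "Suc n \<le> n" unfolding n_def by (rule Greatest_le_nat[where b=m]) auto
      then show False by simp
    qed
    with n show ?thesis by blast
  qed
  then obtain f where f: "\<And>i. x $ i \<le> r ^ f i" "\<And>i. f i = m \<or> r ^ Suc (f i) < x $ i" by metis
  have card_Suc: "sum (\<lambda>i. Suc (f i)) UNIV = sum f UNIV + CARD('s)"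
    using sum.distrib[of f "\<lambda>_. 1" UNIV] by simp
  show ?thesis
  proof (cases "m - CARD('s) \<le> sum f UNIV")
    case True
    then obtain g where g: "g \<le> f" "sum g UNIV = m - CARD('s)" using exists_smaller_exponents by blast
    have "x \<le> grid_point r g"
    proof -
      have "x $ i \<le> r ^ g i" for i
        using f(1)[of i] power_decreasing[of "g i" "f i" r] g(1) r by (auto simp: le_fun_def intro: order_trans)
      then show ?thesis by (simp add: less_eq_vec_def grid_point_def)
    qed
    then have "anchored_box x \<subseteq> anchored_box (grid_point r g)" by (rule anchored_box_mono)
    moreover have "anchored_box (grid_point r g) \<in> grid_boxes r m"
      using g by (auto simp: grid_boxes_def exponents_def)
    moreover have "measure lborel (anchored_box (grid_point r g)) = r ^ (m - CARD('s))"
      using measure_grid_box[of r g] g r by simp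
    ultimately show ?thesis by (intro bexI[of _ "{}"] bexI) auto
  next
    case False
    then have le: "sum f UNIV + CARD('s) \<le> m" using m by linarith
    have "f i < m" for i
    proof -
      have "f i \<le> sum f UNIV" by (rule member_le_sum) auto
      then show ?thesis using le zero_less_card_finite[where 'a='s] by linarith
    qed
    then have low: "r ^ Suc (f i) < x $ i" for i using f(2)[of i] by (metis less_irrefl)
    let ?g = "\<lambda>i. Suc (f i)"
    have "grid_point r ?g \<le> x" using low by (auto simp: less_eq_vec_def grid_point_def less_imp_le)
    moreover have "x \<le> grid_point r f" using f by (auto simp: less_eq_vec_def grid_point_def)
    moreover have "anchored_box (grid_point r ?g) \<in> grid_boxes r m"
      unfolding grid_boxes_def exponents_def using le card_Suc by (intro imageI) simp
    moreover have "anchored_box (grid_point r f) \<in> grid_boxes r m"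
      using le by (auto simp: grid_boxes_def exponents_def)
    moreover have "measure lborel (anchored_box (grid_point r f))
        - measure lborel (anchored_box (grid_point r ?g)) \<le> 1 - r ^ CARD('s)"
    proof -
      have "r ^ sum f UNIV * (1 - r ^ CARD('s)) \<le> 1 * (1 - r ^ CARD('s))"
        using r by (intro mult_right_mono) (auto simp: power_le_one)
      then show ?thesis
        using r by (simp only: measure_grid_box less_imp_le card_Suc power_add) (simp add: algebra_simps)
    qed
    ultimately show ?thesis
      by (intro bexI[of _ "anchored_box (grid_point r ?g)"] bexI[of _ "anchored_box (grid_point r f)"])
        (auto intro: anchored_box_mono[THEN subsetD] max.coboundedI1)
  qed
qed

section \<open>The multiscale families\<close>

text \<open>The family of scale \<open>4^(-k)\<close>, empty for \<open>k = 0\<close>. The ratio satisfies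
  \<open>r ^ CARD('s) = exp (- 4^(-k))\<close>. The bound on the exponent sum is
  \<open>CARD('s) * (6 * k * 4^(k - 1) + 1)\<close>; since \<open>6 * k * 4^(k - 1) / 4^k = 3 * k / 2\<close>, boxes near the
  cut-off have volume about \<open>exp (- 3 * k / 2)\<close>, which is below \<open>4^(-k)\<close>.\<close>
definition level_family :: "nat \<Rightarrow> (real ^ 's::finite) set set" where
  "level_family k = (if k = 0 then {}
     else grid_boxes (exp (- ((1/4) ^ k / real CARD('s)))) (CARD('s) * (6 * k * 4 ^ (k - 1) + 1)))"

lemma finite_level_family: "finite (level_family k)"
  by (simp add: level_family_def grid_boxes_def finite_exponents)

lemma card_level_family_le:
  "real (card (level_family (Suc k) :: (real ^ 's::finite) set set)) \<le> (exp 1 * 8 ^ Suc k) ^ CARD('s)"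
proof -
  let ?M = "6 * Suc k * 4 ^ k + 1"
  have "real (card (level_family (Suc k) :: (real ^ 's) set set))
      \<le> real (card (exponents (CARD('s) * ?M) :: ('s \<Rightarrow> nat) set))"
    by (simp add: level_family_def grid_boxes_def card_image_le finite_exponents)
  also have "\<dots> \<le> (exp 1 * (real ?M + 1)) ^ CARD('s)" by (rule card_exponents_le) simp
  also have "\<dots> \<le> (exp 1 * 8 ^ Suc k) ^ CARD('s)"
  proof (intro power_mono mult_left_mono)
    show "real ?M + 1 \<le> 8 ^ Suc k"
    proof (induction k)
      case (Suc k)
      have "real (6 * Suc (Suc k) * 4 ^ Suc k + 1) + 1 \<le> 8 * (real (6 * Suc k * 4 ^ k + 1) + 1)"
        by (simp add: algebra_simps)
      also have "\<dots> \<le> 8 * 8 ^ Suc k" using Suc by (intro mult_left_mono) auto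
      finally show ?case by simp
    qed simp
  qed auto
  finally show ?thesis .
qed

lemma level_bracket:
  fixes x :: "real ^ 's::finite"
  assumes x: "x \<in> unit_box"
  shows "\<exists>A \<in> insert {} (level_family (Suc k)). \<exists>B \<in> level_family (Suc k). A \<subseteq> anchored_box x \<and>
           anchored_box x \<subseteq> B \<and> measure lborel B - measure lborel A \<le> (1/4) ^ Suc k"
proof -
  let ?s = "CARD('s)"
  define r where "r = exp (- ((1/4) ^ Suc k / real ?s))"
  let ?m = "?s * (6 * Suc k * 4 ^ k + 1)"
  have r: "0 < r" "r < 1" by (auto simp: r_def)
  have fam: "level_family (Suc k) = (grid_boxes r ?m :: (real ^ 's) set set)"
    by (simp add: level_family_def r_def)
  have "r ^ ?s = exp (- ((1/4) ^ Suc k))"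
    by (simp add: r_def exp_of_nat_mult[symmetric])
  then have 1: "1 - r ^ ?s \<le> (1/4) ^ Suc k"
    using exp_ge_add_one_self[of "- ((1/4) ^ Suc k)"] by simp
  have "(2::real) \<le> exp (3/4)" using exp_lower_Taylor_quadratic[of "3/4"] by (simp add: power2_eq_square)
  then have "(2::real) ^ 2 \<le> exp (3/4) ^ 2" by (intro power_mono) auto
  then have e4: "4 \<le> exp (3/2 :: real)" by (simp add: exp_of_nat_mult[symmetric])
  have "r ^ (?m - ?s) = r ^ (?s * (6 * Suc k * 4 ^ k))" by (simp add: algebra_simps)
  also have "\<dots> = exp (real (?s * (6 * Suc k * 4 ^ k)) * - ((1/4) ^ Suc k / real ?s))"
    unfolding r_def by (rule exp_of_nat_mult[symmetric])
  also have "real (?s * (6 * Suc k * 4 ^ k)) * - ((1/4) ^ Suc k / real ?s) = real (Suc k) * - (3/2)"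
    by (simp add: field_simps power_divide)
  also have "exp (real (Suc k) * - (3/2)) = exp (- (3/2)) ^ Suc k" by (rule exp_of_nat_mult)
  also have "\<dots> \<le> (1/4) ^ Suc k"
    using e4 by (intro power_mono) (auto simp: exp_minus field_simps)
  finally have 2: "r ^ (?m - ?s) \<le> (1/4) ^ Suc k" .
  have "?s \<le> ?m" by simp
  from grid_bracket[OF x r this] 1 2 show ?thesis
    unfolding fam by (meson max.bounded_iff order_trans)
qed

lemma level_familyD: "B \<in> level_family k \<Longrightarrow> \<exists>x\<in>unit_box. B = anchored_box x"
  by (auto simp: level_family_def grid_boxes_def split: if_splits intro!: bexI grid_point_in_unit_box)

lemma level_family_fmeasurable:
  "B \<in> insert {} (level_family k) \<Longrightarrow> B \<in> fmeasurable lborel"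
  using level_familyD[of B k] by (auto intro: anchored_box_fmeasurable)

text \<open>Unlike \<open>level_bracket\<close> this includes \<open>k = 0\<close>, where the empty set is within \<open>1\<close> of every box.\<close>

lemma level_below:
  fixes x :: "real ^ 's::finite"
  assumes x: "x \<in> unit_box"
  shows "\<exists>A \<in> insert {} (level_family k). A \<subseteq> anchored_box x \<and>
           measure lborel (anchored_box x - A) \<le> (1/4) ^ k"
proof (cases k)
  case 0
  have "measure lborel (anchored_box x) \<le> measure lborel (unit_box :: (real ^ 's) set)"
    by (rule measure_mono_fmeasurable)
      (auto simp: unit_box_eq_anchored_box in_anchored_box_iff intro: anchored_box_fmeasurable)
  with 0 show ?thesis by (auto simp: measure_unit_box)
next
  case (Suc j)
  obtain A B where A: "A \<in> insert {} (level_family k)" "A \<subseteq> anchored_box x"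
    and B: "B \<in> level_family k" "anchored_box x \<subseteq> B"
    and d: "measure lborel B - measure lborel A \<le> (1/4) ^ k"
    using level_bracket[OF x, of j] unfolding Suc by blast
  note fm = level_family_fmeasurable[OF A(1)] level_family_fmeasurable[of B k]
  have "measure lborel (anchored_box x - A) = measure lborel (anchored_box x) - measure lborel A"
    using A fm by (intro measurable_measure_Diff) (auto simp: anchored_box_fmeasurable fmeasurableD)
  also have "measure lborel (anchored_box x) \<le> measure lborel B"
    using B fm by (intro measure_mono_fmeasurable) auto
  finally show ?thesis using A d by fastforce
qed

text \<open>An inner approximation of \<open>B\<close> at scale \<open>4^(-k)\<close>, chosen arbitrarily among the admissible ones.\<close>

definition parent :: "nat \<Rightarrow> (real ^ 's::finite) set \<Rightarrow> (real ^ 's) set" where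
  "parent k B = (SOME A. A \<in> insert {} (level_family k) \<and> A \<subseteq> B \<and> measure lborel (B - A) \<le> (1/4) ^ k)"

lemma parent:
  assumes "B \<in> level_family j"
  shows "parent k B \<in> insert {} (level_family k)" "parent k B \<subseteq> B"
    and "measure lborel (B - parent k B) \<le> (1/4) ^ k"
proof -
  obtain x where "x \<in> unit_box" "B = anchored_box x" using level_familyD[OF assms] by blast
  then have "\<exists>A. A \<in> insert {} (level_family k) \<and> A \<subseteq> B \<and> measure lborel (B - A) \<le> (1/4) ^ k"
    using level_below[of x k] by blast
  from someI_ex[OF this, folded parent_def]
  show "parent k B \<in> insert {} (level_family k)" "parent k B \<subseteq> B"
    "measure lborel (B - parent k B) \<le> (1/4) ^ k" by auto
qed

section \<open>Chaining\<close>

text \<open>The signed local discrepancy \<open>\<nu>(A)\<close> of the points \<open>w 1, \<dots>, w N\<close>.\<close>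

definition local_disc :: "nat \<Rightarrow> (nat \<Rightarrow> real ^ 's) \<Rightarrow> (real ^ 's::finite) set \<Rightarrow> real" where
  "local_disc N w A = (1 / real N) * (\<Sum>n = 1..N. indicator A (w n)) - measure lborel A"

lemma local_disc_empty[simp]: "local_disc N w {} = 0"
  by (simp add: local_disc_def)

lemma local_disc_Diff:
  assumes "A \<in> fmeasurable lborel" "B \<in> fmeasurable lborel" "A \<subseteq> B"
  shows "local_disc N w B = local_disc N w A + local_disc N w (B - A)"
proof -
  have "measure lborel (B - A) = measure lborel B - measure lborel A"
    using assms by (intro measurable_measure_Diff) (auto simp: fmeasurableD)
  moreover have "indicator B v = indicator A v + (indicator (B - A) v :: real)" for v
    using assms(3) by (auto simp: indicator_def)
  ultimately show ?thesis by (simp add: local_disc_def sum.distrib algebra_simps)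
qed

lemma local_disc_chain:
  assumes t: "\<And>k B. k < K \<Longrightarrow> B \<in> level_family (Suc k) \<Longrightarrow>
                \<bar>local_disc N w (B - parent k B)\<bar> \<le> t k"
    and t0: "\<And>k. 0 \<le> t k"
    and B: "B \<in> insert {} (level_family K)"
  shows "\<bar>local_disc N w B\<bar> \<le> (\<Sum>k<K. t k)"
  using t B
proof (induction K arbitrary: B)
  case 0
  then show ?case by (simp add: level_family_def)
next
  case (Suc K)
  show ?case
  proof (cases "B = {}")
    case True
    then show ?thesis using t0 by (simp add: sum_nonneg)
  next
    case False
    with Suc.prems have B: "B \<in> level_family (Suc K)" by auto
    note p = parent[OF B, of K]
    have "\<bar>local_disc N w (parent K B)\<bar> \<le> (\<Sum>k<K. t k)"
      by (rule Suc.IH[OF _ p(1)]) (use Suc.prems in auto)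
    moreover have "\<bar>local_disc N w (B - parent K B)\<bar> \<le> t K" using Suc.prems(1) B by auto
    moreover have "local_disc N w B = local_disc N w (parent K B) + local_disc N w (B - parent K B)"
      using p B by (intro local_disc_Diff level_family_fmeasurable) auto
    ultimately show ?thesis by simp
  qed
qed

text \<open>Monotonicity of both the counting measure and Lebesgue measure bounds the local discrepancy of a box
  by those of its two bracketing sets, up to the measure of the bracket.\<close>

lemma local_disc_box_le:
  fixes x :: "real ^ 's::finite"
  assumes t: "\<And>k B. k < K \<Longrightarrow> B \<in> level_family (Suc k) \<Longrightarrow>
                \<bar>local_disc N w (B - parent k B)\<bar> \<le> t k"
    and t0: "\<And>k. 0 \<le> t k"
    and K: "K > 0" and x: "x \<in> unit_box"
  shows "\<bar>local_disc N w (anchored_box x)\<bar> \<le> (\<Sum>k<K. t k) + (1/4) ^ K"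
proof -
  obtain A B where A: "A \<in> insert {} (level_family K)" "A \<subseteq> anchored_box x"
    and B: "B \<in> level_family K" "anchored_box x \<subseteq> B"
    and d: "measure lborel B - measure lborel A \<le> (1/4) ^ K"
    using level_bracket[OF x, of "K - 1"] K by (auto simp only: Suc_diff_1)
  note fm = level_family_fmeasurable[OF A(1)] level_family_fmeasurable[of B K]
  let ?c = "\<lambda>A. (1 / real N) * (\<Sum>n = 1..N. indicator A (w n)) :: real"
  have "?c C \<le> ?c D" if "C \<subseteq> D" for C D
    using that by (intro mult_left_mono sum_mono) (auto split: split_indicator)
  then have "?c A \<le> ?c (anchored_box x)" "?c (anchored_box x) \<le> ?c B" using A B by blast+
  moreover have "measure lborel A \<le> measure lborel (anchored_box x)"
    using A fm by (intro measure_mono_fmeasurable) (auto simp: anchored_box_fmeasurable fmeasurableD)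
  moreover have "measure lborel (anchored_box x) \<le> measure lborel B"
    using B fm by (intro measure_mono_fmeasurable) auto
  moreover have "\<bar>local_disc N w A\<bar> \<le> (\<Sum>k<K. t k)" "\<bar>local_disc N w B\<bar> \<le> (\<Sum>k<K. t k)"
    using A B by (intro local_disc_chain t t0; auto)+
  ultimately show ?thesis using d unfolding local_disc_def by linarith
qed

lemma abs_local_disc_le_1: "\<bar>local_disc N w (anchored_box x)\<bar> \<le> 1"
proof -
  let ?S = "\<Sum>n = 1..N. indicator (anchored_box x) (w n) :: real"
  have "?S \<le> (\<Sum>n = 1..N. 1)" by (intro sum_mono) (auto simp: indicator_def)
  then have "(1 / real N) * ?S \<le> 1" by (cases "N = 0") (auto simp: field_simps)
  moreover have "0 \<le> (1 / real N) * ?S" by (intro mult_nonneg_nonneg sum_nonneg) auto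
  moreover have "measure lborel (anchored_box x) \<le> measure lborel (unit_box :: (real ^ 'a) set)"
    by (rule measure_mono_fmeasurable)
      (auto simp: unit_box_eq_anchored_box in_anchored_box_iff intro: anchored_box_fmeasurable)
  ultimately show ?thesis unfolding local_disc_def measure_unit_box
    by (smt (verit) measure_nonneg)
qed

lemma star_discrepancy_le_iff:
  "star_discrepancy N w \<le> e \<longleftrightarrow> (\<forall>x\<in>unit_box. \<bar>local_disc N w (anchored_box x)\<bar> \<le> e)"
  unfolding star_discrepancy_def local_disc_def[symmetric]
proof (rule cSUP_le_iff)
  show "unit_box \<noteq> {}" using one_in_unit_box by auto
  show "bdd_above ((\<lambda>x. \<bar>local_disc N w (anchored_box x)\<bar>) ` unit_box)"
    using abs_local_disc_le_1 by (intro bdd_aboveI2[where M=1]) auto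
qed

section \<open>Reduction to countably many boxes\<close>

text \<open>The points of the unit cube with rational coordinates. Testing these alone determines the star
  discrepancy, which makes its sublevel sets measurable.\<close>

definition rational_points :: "(real ^ 's::finite) set" where
  "rational_points = {x \<in> unit_box. \<forall>i. x $ i \<in> \<rat>}"

lemma countable_rational_points: "countable (rational_points :: (real ^ 's::finite) set)"
proof (rule countable_subset)
  show "rational_points \<subseteq> {x :: real ^ 's. \<forall>i. x $ i \<in> \<rat>}" by (auto simp: rational_points_def)
qed (intro countable_vector countable_rat)

text \<open>The local discrepancy of a box is continuous from above in the corner, because the boxes are
  closed; a general approximation of \<open>x\<close> would not do.\<close>

lemma local_disc_rational_limit:
  fixes x :: "real ^ 's::finite"
  assumes x: "x \<in> unit_box"
  shows "\<exists>y. (\<forall>m. y m \<in> rational_points) \<and>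
           (\<lambda>m. local_disc N w (anchored_box (y m))) \<longlonglongrightarrow> local_disc N w (anchored_box x)"
proof -
  \<comment> \<open>Rounding up keeps the points above \<open>x\<close>, and inside the cube since \<open>x \<le> 1\<close>.\<close>
  define y where "y m = (\<chi> i. of_int \<lceil>real (Suc m) * x $ i\<rceil> / real (Suc m))" for m
  have lo: "x $ i \<le> y m $ i" for m i
    using le_of_int_ceiling[of "real (Suc m) * x $ i"] by (simp add: y_def field_simps)
  have hi: "y m $ i \<le> x $ i + 1 / real (Suc m)" for m i
  proof -
    have "of_int \<lceil>real (Suc m) * x $ i\<rceil> \<le> real (Suc m) * x $ i + 1" by linarith
    then have "y m $ i \<le> (real (Suc m) * x $ i + 1) / real (Suc m)"
      unfolding y_def vec_lambda_beta by (intro divide_right_mono) auto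
    then show ?thesis by (simp add: add_divide_distrib)
  qed
  have one: "y m $ i \<le> 1" for m i
  proof -
    have "real (Suc m) * x $ i \<le> real (Suc m) * 1"
      using x by (intro mult_left_mono) (auto simp: in_unit_box_iff)
    then have "\<lceil>real (Suc m) * x $ i\<rceil> \<le> int (Suc m)" by (simp add: ceiling_le_iff)
    then have "(of_int \<lceil>real (Suc m) * x $ i\<rceil> :: real) \<le> real (Suc m)" by linarith
    then show ?thesis by (simp add: y_def)
  qed
  have lim: "(\<lambda>m. y m $ i) \<longlonglongrightarrow> x $ i" for i
  proof (rule tendsto_sandwich[where f="\<lambda>_. x $ i"])
    show "(\<lambda>m. x $ i + 1 / real (Suc m)) \<longlonglongrightarrow> x $ i"
      using tendsto_add[OF tendsto_const LIMSEQ_inverse_real_of_nat, of "x $ i"]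
      by (simp add: inverse_eq_divide)
  qed (use lo hi in auto)
  have yu: "y m \<in> unit_box" for m
    using lo one x order_trans unfolding in_unit_box_iff by blast
  have rat: "y m \<in> rational_points" for m
    using yu[of m] by (auto simp: rational_points_def y_def)
  have "(\<lambda>m. indicator (anchored_box (y m)) v :: real) \<longlonglongrightarrow> indicator (anchored_box x) v" for v
  proof (rule tendsto_eventually)
    show "\<forall>\<^sub>F m in sequentially. indicator (anchored_box (y m)) v = (indicator (anchored_box x) v :: real)"
    proof (cases "v \<in> anchored_box x \<or> v \<notin> unit_box")
      case True
      then have "v \<in> anchored_box (y m) \<longleftrightarrow> v \<in> anchored_box x" for m
        using lo[of _ m] unfolding in_anchored_box_iff in_unit_box_iff by (meson order_trans)
      then show ?thesis by (simp add: indicator_def)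
    next
      case False
      then obtain i where i: "x $ i < v $ i"
        unfolding in_anchored_box_iff in_unit_box_iff by (meson not_le)
      have "\<forall>\<^sub>F m in sequentially. y m $ i < v $ i"
        using lim[of i] i by (rule order_tendstoD)
      then show ?thesis
      proof (rule eventually_mono)
        fix m assume "y m $ i < v $ i"
        then have "v \<notin> anchored_box (y m)" by (auto simp: in_anchored_box_iff not_le)
        then show "indicator (anchored_box (y m)) v = (indicator (anchored_box x) v :: real)"
          using False by simp
      qed
    qed
  qed
  then have "(\<lambda>m. local_disc N w (anchored_box (y m))) \<longlonglongrightarrow> local_disc N w (anchored_box x)"
    unfolding local_disc_def measure_anchored_box[OF x] measure_anchored_box[OF yu]
    by (intro tendsto_intros lim)
  with rat show ?thesis by blast
qed

lemma star_discrepancy_le_iff_rational: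
  "star_discrepancy N w \<le> e \<longleftrightarrow> (\<forall>x\<in>rational_points. \<bar>local_disc N w (anchored_box x)\<bar> \<le> e)"
  unfolding star_discrepancy_le_iff
proof safe
  fix x :: "real ^ 'a" assume *: "\<forall>x\<in>rational_points. \<bar>local_disc N w (anchored_box x)\<bar> \<le> e" "x \<in> unit_box"
  then obtain y where y: "\<And>m. y m \<in> rational_points"
    "(\<lambda>m. local_disc N w (anchored_box (y m))) \<longlonglongrightarrow> local_disc N w (anchored_box x)"
    using local_disc_rational_limit by blast
  show "\<bar>local_disc N w (anchored_box x)\<bar> \<le> e"
    by (rule LIMSEQ_le_const2[OF tendsto_rabs[OF y(2)]]) (use * y in auto)
qed (auto simp: rational_points_def)

section \<open>The union bound\<close>

text \<open>At a chaining step with index \<open>k\<close> the left-hand side is, per dimension, the logarithm of the number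
  of increments and of all other factors
  to be absorbed, with \<open>25 / 36\<close> as an upper bound for \<open>ln 2\<close>. The inequality is
  nearly tight at \<open>k = 1\<close>; from there on the left grows by less than the factor \<open>1.44\<close>.\<close>
lemma union_bound_exponent:
  "1 + 25/36 * (5 + 4 * real k) \<le> 0.09 * 32.49 / 2.8 * 4.9 * 1.44 ^ k"
proof (cases k)
  case (Suc j)
  have "1 + 25/36 * (9 + 4 * real j) \<le> 0.09 * 32.49 / 2.8 * 4.9 * 1.44 ^ Suc j"
  proof (induction j)
    case (Suc j)
    have "1 + 25/36 * (9 + 4 * real (Suc j)) \<le> 1.44 * (1 + 25/36 * (9 + 4 * real j))"
      by simp
    also have "\<dots> \<le> 1.44 * (0.09 * 32.49 / 2.8 * 4.9 * 1.44 ^ Suc j)"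
      using Suc by (intro mult_left_mono) auto
    finally show ?case by simp
  qed simp
  then show ?thesis by (simp add: Suc)
qed simp

text \<open>The number of increments times the Bernstein bound for each. The factor \<open>1.44 = 0.6\<^sup>2 * 4\<close> compares
  the squared threshold with the measure of the increments.\<close>

lemma level_failure_le:
  fixes s k :: nat and L e N :: real
  assumes s: "s \<ge> 1" and L: "L \<ge> 0" and e: "N * e\<^sup>2 = 32.49 * (4.9 * real s + L)"
  shows "(exp 1 * 8 ^ Suc k) ^ s * (2 * exp (- N * (0.3 * 0.6 ^ k * e)\<^sup>2 / (2.8 * (1/4) ^ k)))
           \<le> (1/2) ^ Suc k * exp (- L)"
proof -
  let ?l = "ln (2::real)"
  let ?C = "0.09 * 32.49 / 2.8 :: real"
  have two: "exp ?l = 2" by simp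
  have 8: "(8::real) = exp (3 * ?l)"
    using exp_of_nat_mult[of 3 ?l] by simp
  have half: "(1/2::real) = exp (- ?l)" by (simp add: exp_minus)
  have a: "(exp 1 * 8 ^ Suc k) ^ s = exp (real s * (1 + real (Suc k) * (3 * ?l)))"
    unfolding 8 by (simp only: exp_of_nat_mult exp_add)
  have b: "- N * (0.3 * 0.6 ^ k * e)\<^sup>2 / (2.8 * (1/4) ^ k)
      = - (?C * 1.44 ^ k * (4.9 * real s + L))"
  proof -
    have "N * (0.3 * 0.6 ^ k * e)\<^sup>2 / (2.8 * (1/4) ^ k) = 0.09 / 2.8 * (N * e\<^sup>2) * ((0.6 ^ k)\<^sup>2 / (1/4) ^ k)"
      by (simp add: power_mult_distrib power2_eq_square)
    also have "(0.6 ^ k)\<^sup>2 / (1/4) ^ k = (1.44 :: real) ^ k"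
    proof -
      have "(0.6 ^ k)\<^sup>2 = (0.36 :: real) ^ k"
        unfolding power_mult[symmetric] mult.commute[of k 2] unfolding power_mult
        by (simp add: power2_eq_square)
      then show ?thesis by (simp add: power_divide[symmetric])
    qed
    finally show ?thesis unfolding e by (simp add: algebra_simps)
  qed
  \<comment> \<open>The factors \<open>2\<close> and \<open>2 ^ Suc k\<close> do not depend on the dimension and are absorbed using \<open>s \<ge> 1\<close>.\<close>
  have "real s * (1 + real (Suc k) * (3 * ?l)) + (?l + real (Suc k) * ?l)
      \<le> real s * (1 + real (Suc k) * (3 * ?l)) + real s * (?l + real (Suc k) * ?l)"
    using s mult_right_mono[of 1 "real s" "?l + real (Suc k) * ?l"] by simp
  also have "\<dots> = real s * (1 + ?l * (5 + 4 * real k))"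
    by (simp add: algebra_simps)
  also have "\<dots> \<le> real s * (1 + 25/36 * (5 + 4 * real k))"
    using ln2_le_25_over_36 by (intro mult_left_mono add_left_mono mult_right_mono) auto
  also have "\<dots> \<le> real s * (?C * 4.9 * 1.44 ^ k)"
    by (intro mult_left_mono union_bound_exponent) simp
  finally have 1: "real s * (1 + real (Suc k) * (3 * ?l)) + (?l + real (Suc k) * ?l)
      \<le> real s * (?C * 4.9 * 1.44 ^ k)" .
  have "1 \<le> ?C * x" if "1 \<le> x" for x :: real using that by simp
  from this[of "1.44 ^ k"] have "1 \<le> ?C * 1.44 ^ k" by (simp add: one_le_power)
  then have "1 * L \<le> (?C * 1.44 ^ k) * L"
    using L by (rule mult_right_mono)
  with 1 have "real s * (1 + real (Suc k) * (3 * ?l)) + (?l + - (?C * 1.44 ^ k * (4.9 * real s + L)))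
      \<le> real (Suc k) * (- ?l) + - L"
    by (simp add: algebra_simps)
  then have "exp (real s * (1 + real (Suc k) * (3 * ?l)) + (?l + - (?C * 1.44 ^ k * (4.9 * real s + L))))
      \<le> exp (real (Suc k) * (- ?l) + - L)" by simp
  then show ?thesis
    unfolding a b half exp_add exp_of_nat_mult two by simp
qed

lemma (in prob_space) prob_vimage_uniform:
  assumes z: "z \<in> borel_measurable M" and d: "distr M borel z = uniform_measure lborel (unit_box :: (real ^ 's::finite) set)"
    and S: "S \<in> sets borel" "S \<subseteq> unit_box"
  shows "prob (z -` S \<inter> space M) = measure lborel S"
proof -
  have "prob (z -` S \<inter> space M) = measure (distr M borel z) S"
    using z S by (simp add: measure_distr)
  also have "\<dots> = measure lborel S"
    unfolding d using S by (simp add: emeasure_unit_box measure_unit_box Int_absorb1)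
  finally show ?thesis .
qed

lemma (in prob_space) star_discrepancy_le_event:
  fixes z :: "nat \<Rightarrow> 'a \<Rightarrow> real ^ 's::finite"
  assumes [measurable]: "\<And>n. n \<in> {1..N} \<Longrightarrow> z n \<in> borel_measurable M"
  shows "{\<omega> \<in> space M. star_discrepancy N (\<lambda>n. z n \<omega>) \<le> e} \<in> events"
proof -
  let ?C = "\<lambda>x. {\<omega> \<in> space M. \<not> \<bar>local_disc N (\<lambda>n. z n \<omega>) (anchored_box x)\<bar> \<le> e}"
  have "?C x \<in> events" for x
    unfolding local_disc_def by measurable
  then have "space M - (\<Union>x\<in>rational_points. ?C x) \<in> events"
    by (intro sets.compl_sets sets.countable_UN' countable_rational_points) auto
  also have "space M - (\<Union>x\<in>rational_points. ?C x)
      = {\<omega> \<in> space M. star_discrepancy N (\<lambda>n. z n \<omega>) \<le> e}"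
    by (auto simp: star_discrepancy_le_iff_rational)
  finally show ?thesis .
qed

lemma (in prob_space) prob_bad_level_le:
  fixes z :: "nat \<Rightarrow> 'a \<Rightarrow> real ^ 's::finite"
  assumes N: "N \<ge> 1" and indep: "indep_vars (\<lambda>_. borel) z {1..N}"
    and unif: "\<And>n. n \<in> {1..N} \<Longrightarrow> distr M borel (z n) = uniform_measure lborel unit_box"
    and B: "B \<in> level_family j" and t: "0 \<le> t" "t \<le> 1.2 * (1/4) ^ k"
  shows "prob {\<omega> \<in> space M. \<bar>local_disc N (\<lambda>n. z n \<omega>) (B - parent k B)\<bar> > t}
           \<le> 2 * exp (- real N * t\<^sup>2 / (2.8 * (1/4) ^ k))"
proof -
  note p = parent[OF B, of k]
  let ?S = "B - parent k B"
  have S: "?S \<in> sets borel"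
    using level_family_fmeasurable[OF p(1), THEN fmeasurableD]
      level_family_fmeasurable[of B j, THEN fmeasurableD] B by auto
  have sub: "?S \<subseteq> unit_box" using level_familyD[OF B] by (auto simp: anchored_box_def)
  have "prob (z n -` ?S \<inter> space M) = measure lborel ?S" if "n \<in> {1..N}" for n
    using that indep by (intro prob_vimage_uniform unif S sub) (auto simp: indep_vars_def)
  from bernstein_sum_indicator[OF indep _ _ S this p(3) _ t] N
  show ?thesis by (simp add: local_disc_def)
qed

section \<open>The probabilistic discrepancy bound\<close>

theorem theorem1:
  fixes M :: "'a measure"
    and z :: "nat \<Rightarrow> 'a \<Rightarrow> real ^ 's"
    and N :: nat
    and q :: real
  assumes "prob_space M"
    and "N \<ge> 1"
    and "0 < q" and "q < 1"
    and "prob_space.indep_vars M (\<lambda>_. borel) z {1..N}"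
    and "\<And>n. n \<in> {1..N} \<Longrightarrow> distr M borel (z n) = uniform_measure lborel unit_box"
  shows "measure M {\<omega> \<in> space M.
           star_discrepancy N (\<lambda>n. z n \<omega>)
             \<le> 5.7 * sqrt (4.9 + ln (inverse (1 - q)) / real CARD('s))
                 * (sqrt (real CARD('s)) / sqrt (real N))} \<ge> q"
proof -
  interpret prob_space M by fact
  define s where "s = CARD('s)"
  define L where "L = ln (inverse (1 - q))"
  define e where "e = 5.7 * sqrt (4.9 + L / real s) * (sqrt (real s) / sqrt (real N))"
  have s: "s \<ge> 1" by (simp add: s_def Suc_le_eq)
  have expL: "exp (- L) = 1 - q" using assms by (simp add: L_def ln_inverse)
  have "inverse (1 - q) \<ge> 1" using assms by (intro one_le_inverse) auto
  then have L: "L \<ge> 0" unfolding L_def by (rule ln_ge_zero)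
  have "4.9 + L / real s > 0" using L s by (simp add: add_pos_nonneg)
  then have e0: "e > 0" using s assms by (simp add: e_def)
  have "e\<^sup>2 = 32.49 * (4.9 + L / real s) * (real s / real N)"
    using \<open>4.9 + L / real s > 0\<close> unfolding e_def by (simp add: power_mult_distrib power_divide)
  then have "real N * e\<^sup>2 = 32.49 * ((4.9 + L / real s) * real s)"
    using assms by simp
  also have "(4.9 + L / real s) * real s = 4.9 * real s + L" using s by (simp add: distrib_right)
  finally have Ne: "real N * e\<^sup>2 = 32.49 * (4.9 * real s + L)" .
  have rv: "z n \<in> borel_measurable M" if "n \<in> {1..N}" for n
    using assms(5) that by (auto simp: indep_vars_def)
  note [measurable] = star_discrepancy_le_event[OF rv]
  let ?G = "{\<omega> \<in> space M. star_discrepancy N (\<lambda>n. z n \<omega>) \<le> e}"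
  have "prob ?G \<ge> q"
  proof (cases "e \<ge> 1")
    case True
    then have "?G = space M"
      using order_trans[OF abs_local_disc_le_1 True] by (auto simp: star_discrepancy_le_iff)
    then show ?thesis using assms by (simp add: prob_space)
  next
    case False
    \<comment> \<open>Minimality of \<open>K\<close> keeps \<open>e\<close> below \<open>4 * 4^(-k)\<close> at all levels in use, as the Bernstein bound needs.\<close>
    let ?Q = "\<lambda>K. (1/4 :: real) ^ K \<le> e / 4"
    define K where "K = (LEAST K. ?Q K)"
    obtain K0 where "(1/4 :: real) ^ K0 < e / 4"
      using real_arch_pow_inv[of "e/4" "1/4"] e0 by auto
    then have K: "?Q K" unfolding K_def by (intro LeastI) (rule less_imp_le)
    have less_K: "e / 4 < (1/4) ^ k" if "k < K" for k
      using not_less_Least that unfolding K_def by (meson not_le)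
    have "K \<noteq> 0" using K False by (intro notI) simp
    define t where "t k = 0.3 * 0.6 ^ k * e" for k :: nat
    have t0: "0 \<le> t k" for k using e0 by (simp add: t_def)
    have t1: "t k \<le> 1.2 * (1/4) ^ k" if "k < K" for k
    proof -
      have "t k \<le> 0.3 * 1 * e"
        unfolding t_def using e0 by (intro mult_right_mono mult_left_mono power_le_one) auto
      then show ?thesis using less_K[OF that] by simp
    qed
    have sum_t: "(\<Sum>k<K. t k) + (1/4) ^ K \<le> e"
    proof -
      have "(\<Sum>k<K. t k) = 0.3 * e * (\<Sum>k<K. 0.6 ^ k)"
        by (simp add: t_def sum_distrib_left mult_ac)
      also have "(\<Sum>k<K. 0.6 ^ k) \<le> (\<Sum>k. 0.6 ^ k :: real)"
        by (intro sum_le_suminf summable_geometric) auto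
      also have "\<dots> = 5/2" by (subst suminf_geometric) auto
      finally show ?thesis using K e0 by simp
    qed
    define Bad where "Bad k = (\<Union>B\<in>level_family (Suc k).
        {\<omega> \<in> space M. \<bar>local_disc N (\<lambda>n. z n \<omega>) (B - parent k B)\<bar> > t k})" for k
    have single[measurable]: "{\<omega> \<in> space M. \<bar>local_disc N (\<lambda>n. z n \<omega>) (B - parent k B)\<bar> > t k} \<in> events"
      if "B \<in> level_family (Suc k)" for B k
    proof -
      have [measurable]: "B - parent k B \<in> sets borel"
        using level_family_fmeasurable[OF parent(1)[OF that], THEN fmeasurableD]
          level_family_fmeasurable[of B "Suc k", THEN fmeasurableD] that by auto
      note [measurable] = rv
      show ?thesis unfolding local_disc_def by measurable
    qed
    have Bad_event: "Bad k \<in> events" for k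
      unfolding Bad_def using single by (intro sets.finite_UN finite_level_family) auto
    have Bad: "prob (Bad k) \<le> (1/2) ^ Suc k * exp (- L)" if "k < K" for k
    proof -
      let ?F = "level_family (Suc k) :: (real ^ 's) set set"
      let ?b = "2 * exp (- real N * (t k)\<^sup>2 / (2.8 * (1/4) ^ k))"
      have "prob (Bad k) \<le> (\<Sum>B\<in>?F. prob {\<omega> \<in> space M. \<bar>local_disc N (\<lambda>n. z n \<omega>) (B - parent k B)\<bar> > t k})"
        unfolding Bad_def using single by (intro measure_UNION_le finite_level_family) auto
      also have "\<dots> \<le> (\<Sum>B\<in>?F. ?b)"
        by (intro sum_mono prob_bad_level_le assms t0 t1 that)
      also have "\<dots> = real (card ?F) * ?b" by simp
      also have "\<dots> \<le> (exp 1 * 8 ^ Suc k) ^ s * ?b"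
        unfolding s_def by (intro mult_right_mono card_level_family_le) auto
      also have "\<dots> \<le> (1/2) ^ Suc k * exp (- L)"
        unfolding t_def by (rule level_failure_le[OF s L Ne])
      finally show ?thesis .
    qed
    have "prob (\<Union>k<K. Bad k) \<le> (\<Sum>k<K. prob (Bad k))"
      using Bad_event by (intro measure_UNION_le) auto
    also have "\<dots> \<le> (\<Sum>k<K. (1/2) ^ Suc k * exp (- L))" using Bad by (intro sum_mono) auto
    also have "\<dots> = (\<Sum>k<K. (1/2) ^ Suc k) * exp (- L)" by (simp add: sum_distrib_right)
    also have "\<dots> \<le> 1 * exp (- L)"
    proof (intro mult_right_mono)
      have "(\<Sum>k<K. (1/2 :: real) ^ Suc k) \<le> (\<Sum>k. (1/2) ^ Suc k)"
        using power_half_series by (intro sum_le_suminf) (auto simp: sums_iff)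
      also have "\<dots> = 1" using power_half_series by (simp add: sums_iff)
      finally show "(\<Sum>k<K. (1/2 :: real) ^ Suc k) \<le> 1" .
    qed simp
    finally have bad: "prob (\<Union>k<K. Bad k) \<le> 1 - q" by (simp add: expL)
    have "1 - prob (\<Union>k<K. Bad k) = prob (space M - (\<Union>k<K. Bad k))"
      using Bad_event by (intro prob_compl[symmetric]) auto
    also have "\<dots> \<le> prob ?G"
    proof (intro finite_measure_mono subsetI)
      fix \<omega> assume \<omega>: "\<omega> \<in> space M - (\<Union>k<K. Bad k)"
      have "\<bar>local_disc N (\<lambda>n. z n \<omega>) (B - parent k B)\<bar> \<le> t k"
        if "k < K" "B \<in> level_family (Suc k)" for k B
        using \<omega> that unfolding Bad_def by (auto simp: not_less)
      then have "\<bar>local_disc N (\<lambda>n. z n \<omega>) (anchored_box x)\<bar> \<le> e" if "x \<in> unit_box" for x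
        using local_disc_box_le[of K N "\<lambda>n. z n \<omega>" t x] t0 \<open>K \<noteq> 0\<close> that sum_t by fastforce
      then show "\<omega> \<in> ?G" using \<omega> by (simp add: star_discrepancy_le_iff)
    qed measurable
    finally show ?thesis using bad by simp
  qed
  then show ?thesis by (simp add: e_def L_def s_def)
qed

end
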